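(* Let $\sigma_0=1.500127440\cdots$ be the unique real root of the equation $$\sum_{n\ge2}\zeta(2n)\,n^{-\sigma}=\zeta(2)$$ (the series on the left converges exactly for real $\sigma>1$). Then $D(s)\ne0$ for all $s\in\mathbb{C}$ with $\operatorname{Re}(s)\ge\sigma_0$.
   Context: Here $\zeta$ is the Riemann zeta function and $D(s)=\sum_{n\ge1}\zeta(2n)\,n^{-s}$ for $\operatorname{Re}(s)>1$. *)

theory Defs
  imports "HOL-Analysis.Analysis"
begin

text \<open>
  The Riemann zeta function, given by its Dirichlet series.  This is the usual value on the
  half-plane \<open>Re s > 1\<close>; no analytic continuation is set up, so the value elsewhere carries no
  meaning.  Below it is used only at the even integers \<open>2, 4, 6, \<dots>\<close>.
\<close>

definition zeta :: "complex \<Rightarrow> complex" where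
  "zeta s = (\<Sum>\<^sub>\<infinity>n\<in>{1::nat..}. of_nat n powr (- s))"

text \<open>
  Meaningful for \<open>Re s > 1\<close>, where the series converges absolutely.
\<close>

definition D :: "complex \<Rightarrow> complex" where
  "D s = (\<Sum>\<^sub>\<infinity>n\<in>{1::nat..}. zeta (of_nat (2 * n)) * of_nat n powr (- s))"

end

theory Submission
  imports Defs
begin

text \<open>
  Write \<open>F \<sigma>\<close> for the sum of \<open>\<zeta>(2n) n powr -\<sigma>\<close> over \<open>n \<ge> 2\<close>. It is strictly decreasing and continuous for
  \<open>\<sigma> > 1\<close>, so \<open>\<sigma>\<^sub>0\<close> is found between two points where \<open>F - \<zeta>(2)\<close> has opposite signs.
  If \<open>D s = 0\<close> with \<open>Re s \<ge> \<sigma>\<^sub>0\<close>, the terms with \<open>n \<ge> 2\<close> sum to \<open>-\<zeta>(2)\<close> although their absolute values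
  sum to at most \<open>F \<sigma>\<^sub>0 = \<zeta>(2)\<close>; hence all of them are negative reals. This is impossible for both
  \<open>n = 2\<close> and \<open>n = 4\<close>, because \<open>4 powr -s\<close> is the square of \<open>2 powr -s\<close>.

  The two values of \<open>F - \<zeta>(2)\<close> are about \<open>1.4e-9\<close> and \<open>-2.5e-9\<close>. Zeta values are enclosed to that
  accuracy by cutting the Dirichlet series at \<open>N\<close> and bracketing the rest between two consecutive
  Euler-Maclaurin approximations, and \<open>p powr -\<sigma>\<close> for primes \<open>p\<close> is computed as
  \<open>p powr (-3/2) * exp (-(\<sigma> - 3/2) * ln p)\<close>, where \<open>\<sigma> - 3/2\<close> is tiny.
\<close>

section \<open>Euler-Maclaurin bracket for the tail of the zeta series\<close>

text \<open>Newton's binomial series at the two displacements -1/2 and 1/2, which lie inside the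
  disc of convergence since \<open>m > 1/2\<close>. The sign in \<open>-a gchoose n\<close> cancels
  at the left endpoint and survives as an alternation at the right one.\<close>

lemma sums_powr_half_step:
  fixes a m :: real
  assumes "m > 1/2"
  shows "(\<lambda>n. pochhammer a n / fact n * (1/2)^n * m powr (-a - real n))
           sums (m - 1/2) powr (-a)" (is ?A)
    and "(\<lambda>n. (-1)^n * (pochhammer a n / fact n * (1/2)^n * m powr (-a - real n)))
           sums (m + 1/2) powr (-a)" (is ?B)
proof -
  have g: "(-a gchoose n) = (-1)^n * pochhammer a n / fact n" for n
    by (simp add: gbinomial_pochhammer)
  have "(\<lambda>n. (-a gchoose n) * m powr (-a - real n) * (-(1/2))^n) sums (m + -(1/2)) powr (-a)"
    using assms by (intro gen_binomial_real'') auto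
  also have "(\<lambda>n. (-a gchoose n) * m powr (-a - real n) * (-(1/2))^n)
     = (\<lambda>n. pochhammer a n / fact n * (1/2)^n * m powr (-a - real n))"
    by (intro ext, subst power_minus) (simp add: g power_mult_distrib [symmetric] mult_ac)
  finally show ?A by simp
  have "(\<lambda>n. (-a gchoose n) * m powr (-a - real n) * (1/2)^n) sums (m + 1/2) powr (-a)"
    using assms by (intro gen_binomial_real'') auto
  then show ?B by (simp add: g mult_ac)
qed

text \<open>This is the previous expansion with exponent parameter \<open>s + d\<close>, reindexed
  by \<open>n = k + d\<close> so that all orders \<open>d\<close> share the coefficients
  \<open>w n\<close>. The product over \<open>i < d\<close> is the falling factorial of
  \<open>n\<close>; it turns \<open>fact n\<close> into \<open>fact k\<close> and vanishes for
  \<open>n < d\<close>, which lets the shift be undone. In \<open>2 ^ (d+1)\<close>,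
  \<open>d\<close> factors compensate the powers of 1/2 and one compensates the halved parity
  factor.\<close>

lemma sums_powr_diff:
  fixes s m :: real
  assumes "m > 1/2" "odd d"
  defines "w \<equiv> (\<lambda>n. pochhammer s n / fact n * (1/2)^n * m powr (-s - real n))"
  shows "(\<lambda>n. (1 + (-1)^n) / 2 * w n * (2 ^ (d+1) * (\<Prod>i<d. real n - real i))) sums
         (pochhammer s d * ((m - 1/2) powr (-s - real d) - (m + 1/2) powr (-s - real d)))"
proof -
  let ?h = "\<lambda>n. (1 + (-1)^n) / 2 * w n * (2 ^ (d+1) * (\<Prod>i<d. real n - real i))"
  let ?p = "\<lambda>k. pochhammer (s + real d) k / fact k * (1/2)^k * m powr (-(s + real d) - real k)"
  have "(\<lambda>k. pochhammer s d * (?p k - (-1)^k * ?p k)) sums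
     (pochhammer s d * ((m - 1/2) powr (-(s + real d)) - (m + 1/2) powr (-(s + real d))))"
    using sums_powr_half_step[OF assms(1), of "s + real d"]
    by (intro sums_mult sums_diff) simp_all
  also have "(\<lambda>k. pochhammer s d * (?p k - (-1)^k * ?p k)) = (\<lambda>k. ?h (k + d))"
  proof
    fix k
    have prod: "(\<Prod>i<d. real (k + d) - real i) * fact k = (fact (k + d) :: real)"
    proof (induction d)
      case (Suc d)
      have "(\<Prod>i<Suc d. real (k + Suc d) - real i) = real (k + Suc d) * (\<Prod>i<d. real (k + d) - real i)"
        by (subst prod.lessThan_Suc_shift) simp
      with Suc show ?case by (simp add: mult_ac)
    qed simp
    have "pochhammer s (k + d) = pochhammer s d * pochhammer (s + real d) k"
      by (simp add: pochhammer_product' add.commute)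
    moreover have "(2::real) ^ (d + 1) * (1/2) ^ (k + d) = 2 * (1/2)^k"
      by (simp add: power_add power_divide)
    moreover have "(-1::real) ^ (k + d) = - ((-1) ^ k)"
      using assms(2) by (simp add: power_add)
    moreover have "(\<Prod>i<d. real (k + d) - real i) / fact (k + d) = (1 :: real) / fact k"
      using prod by (simp add: field_simps)
    moreover have "-s - real (k + d) = -(s + real d) - real k" by simp
    moreover have "?h (k + d) = (1 + (-1)^(k + d)) / 2 * pochhammer s (k + d)
       * m powr (-s - real (k + d)) * (2 ^ (d+1) * (1/2) ^ (k + d)) *
       ((\<Prod>i<d. real (k + d) - real i) / fact (k + d))"
      unfolding w_def by (simp add: mult_ac)
    ultimately have h: "?h (k + d) = (1 - (-1)^k) / 2 * (pochhammer s d * pochhammer (s + real d) k)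
       * m powr (-(s + real d) - real k) * (2 * (1/2)^k) * (1 / fact k)"
      by (simp only: minus_minus diff_conv_add_uminus [symmetric])
    show "pochhammer s d * (?p k - (-1)^k * ?p k) = ?h (k + d)"
      unfolding h by (simp add: algebra_simps)
  qed
  finally have "(\<lambda>k. ?h (k + d)) sums
     (pochhammer s d * ((m - 1/2) powr (-s - real d) - (m + 1/2) powr (-s - real d)))" by simp
  moreover have "?h i = 0" if "i < d" for i
  proof -
    have "(\<Prod>j<d. real i - real j) = 0" using that by (intro prod_zero) auto
    then show ?thesis by simp
  qed
  ultimately show ?thesis by (subst (asm) sums_zero_iff_shift) auto
qed

text \<open>The Euler-Maclaurin approximation to the sum of \<open>(x + n) powr (-s)\<close> over
  all natural \<open>n\<close>: integral, half of the first term, and the corrections with B_2/2! =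
  1/12 and B_4/4! = -1/720. The constant 1/30240 that appears later is B_6/6!.\<close>

definition em_tail :: "real \<Rightarrow> real \<Rightarrow> real" where
  "em_tail s x = x powr (1 - s) / (s - 1) + x powr (-s) / 2 + s * x powr (-s-1) / 12
     - pochhammer s 3 * x powr (-s-3) / 720"

text \<open>
  Expanding about the midpoint \<open>m = x + 1/2\<close> kills all odd terms, and the remaining coefficients are
  \<open>pochhammer s n\<close> times a rational function of \<open>n\<close> alone, whose sign at even \<open>n\<close> is constant.
\<close>
lemma em_tail_step_sums:
  fixes s x :: real
  assumes "x > 0" "s \<noteq> 1"
  defines "m \<equiv> x + 1/2"
  defines "w \<equiv> (\<lambda>n. (1 + (-1)^n) / 2 * (pochhammer s n / fact n * (1/2)^n * m powr (-s - real n)))"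
  shows "(\<lambda>n. w n / (real n + 1) * (real n * (real n - 2) * (16 - real n ^ 2) / 45))
           sums (em_tail s x - em_tail s (x + 1) - x powr (-s))" (is ?A)
    and "(\<lambda>n. w n / (real n + 1) * (real n * (real n - 2) * (real n - 4) * (real n - 6) *
           (2 * real n ^ 2 + 6 * real n + 13) / 945))
           sums (em_tail s x + pochhammer s 5 * x powr (-s-5) / 30240
              - (em_tail s (x + 1) + pochhammer s 5 * (x + 1) powr (-s-5) / 30240) - x powr (-s))"
      (is ?B)
proof -
  have m: "m > 1/2" and mx: "m - 1/2 = x" "m + 1/2 = x + 1" using assms by (auto simp: m_def)
  define v where "v = (\<lambda>n. pochhammer s n / fact n * (1/2)^n * m powr (-s - real n))"
  have w: "w n = (1 + (-1)^n) / 2 * v n" for n by (simp add: w_def v_def)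
  have d: "(\<lambda>n. w n * (2 ^ (d+1) * (\<Prod>i<d. real n - real i))) sums
         (pochhammer s d * (x powr (-s - real d) - (x+1) powr (-s - real d)))" if "odd d" for d
    using sums_powr_diff[OF m that, of s] unfolding mx w_def .
  have 0: "(\<lambda>n. w n * 2) sums (x powr (-s) + (x+1) powr (-s))"
  proof -
    have "w n * 2 = v n + (-1)^n * v n" for n by (simp add: w algebra_simps)
    then show ?thesis
      using sums_add[OF sums_powr_half_step[OF m, of s]] unfolding mx by (simp only: v_def)
  qed
  \<comment> \<open>The integral term comes from the expansion with \<open>s - 1\<close> in place of
    \<open>s\<close>. Its term at \<open>k = 0\<close> cancels between the endpoints, so the index
    moves by one, and \<open>pochhammer (s - 1) (k+1)\<close> supplies the factor
    \<open>s - 1\<close> that the division removes.\<close>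
  have 1: "(\<lambda>n. w n / (real n + 1)) sums ((x powr (1-s) - (x+1) powr (1-s)) / (s - 1))"
  proof -
    let ?p = "\<lambda>k. pochhammer (s - 1) k / fact k * (1/2)^k * m powr (-(s - 1) - real k)"
    have "(\<lambda>k. (?p k - (-1)^k * ?p k) / (s - 1)) sums
        ((x powr (-(s-1)) - (x+1) powr (-(s-1))) / (s - 1))"
      using sums_powr_half_step[OF m, of "s - 1"] unfolding mx
      by (intro sums_divide sums_diff)
    from sums_split_initial_segment[OF this, of 1]
    have "(\<lambda>k. (?p (k+1) - (-1)^(k+1) * ?p (k+1)) / (s - 1)) sums
        ((x powr (-(s-1)) - (x+1) powr (-(s-1))) / (s - 1))"
      by simp
    moreover have "(?p (k+1) - (-1)^(k+1) * ?p (k+1)) / (s - 1) = w k / (real k + 1)" for k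
    proof -
      have p: "pochhammer (s - 1) (k+1) = (s - 1) * pochhammer s k" by (simp add: pochhammer_rec)
      have f: "fact (k+1) = (real k + 1) * fact k" by simp
      have e: "-(s - 1) - real (k+1) = -s - real k" by simp
      show ?thesis unfolding p f e w v_def using assms(2)
        by (simp add: divide_simps) (simp add: algebra_simps)
    qed
    ultimately show ?thesis by simp
  qed
  \<comment> \<open>Subtracting \<open>x powr (-s)\<close> turns the difference of the two half
    terms into minus the mean of the endpoint values, which explains the sum in \<open>0\<close> and
    its negative sign here.\<close>
  have A: "(\<lambda>n. w n / (real n + 1) - w n * 2 / 2
          + w n * (2 ^ (1+1) * (\<Prod>i<1. real n - real i)) / 12
          - w n * (2 ^ (3+1) * (\<Prod>i<3. real n - real i)) / 720)
     sums ((x powr (1-s) - (x+1) powr (1-s)) / (s - 1) - (x powr (-s) + (x+1) powr (-s)) / 2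
     + (pochhammer s 1 * (x powr (-s - real 1) - (x+1) powr (-s - real 1))) / 12
     - (pochhammer s 3 * (x powr (-s - real 3) - (x+1) powr (-s - real 3))) / 720)"
    by (intro sums_add sums_diff sums_divide 0 1 d) auto
  have B: "(\<lambda>n. (w n / (real n + 1) - w n * 2 / 2
          + w n * (2 ^ (1+1) * (\<Prod>i<1. real n - real i)) / 12
          - w n * (2 ^ (3+1) * (\<Prod>i<3. real n - real i)) / 720)
          + w n * (2 ^ (5+1) * (\<Prod>i<5. real n - real i)) / 30240)
     sums (((x powr (1-s) - (x+1) powr (1-s)) / (s - 1) - (x powr (-s) + (x+1) powr (-s)) / 2
     + (pochhammer s 1 * (x powr (-s - real 1) - (x+1) powr (-s - real 1))) / 12
     - (pochhammer s 3 * (x powr (-s - real 3) - (x+1) powr (-s - real 3))) / 720)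
     + (pochhammer s 5 * (x powr (-s - real 5) - (x+1) powr (-s - real 5))) / 30240)"
    by (intro sums_add[OF A] sums_divide d) auto
  \<comment> \<open>The Bernoulli coefficients are exactly those that make the rational factor
    vanish at 0, 2, 4, and with the next correction also at 6.\<close>
  have poly: "W / (N + 1) - W * 2 / 2 + W * (2 ^ (1+1) * N) / 12 - W * (2 ^ (3+1) * (N * (N - 1) * (N - 2))) / 720
      = W / (N + 1) * (N * (N - 2) * (16 - N ^ 2) / 45)" if "N \<ge> 0" for N W :: real
    using that by (simp add: divide_simps) algebra
  have poly2: "W / (N + 1) - W * 2 / 2 + W * (2 ^ (1+1) * N) / 12 - W * (2 ^ (3+1) * (N * (N - 1) * (N - 2))) / 720
       + W * (2 ^ (5+1) * (N * (N - 1) * (N - 2) * (N - 3) * (N - 4))) / 30240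
      = W / (N + 1) * (N * (N - 2) * (N - 4) * (N - 6) * (2 * N ^ 2 + 6 * N + 13) / 945)" if "N \<ge> 0" for N W :: real
    using that by (simp add: divide_simps) algebra
  have P: "(\<Prod>i<1. real n - real i) = real n"
     "(\<Prod>i<3. real n - real i) = real n * (real n - 1) * (real n - 2)"
     "(\<Prod>i<5. real n - real i) = real n * (real n - 1) * (real n - 2) * (real n - 3) * (real n - 4)" for n
    by (simp_all add: eval_nat_numeral)
  have eA: "(x powr (1-s) - (x+1) powr (1-s)) / (s - 1) - (x powr (-s) + (x+1) powr (-s)) / 2
     + (pochhammer s 1 * (x powr (-s - real 1) - (x+1) powr (-s - real 1))) / 12
     - (pochhammer s 3 * (x powr (-s - real 3) - (x+1) powr (-s - real 3))) / 720
     = em_tail s x - em_tail s (x + 1) - x powr (-s)"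
    unfolding em_tail_def by (simp add: ring_distribs add_divide_distrib diff_divide_distrib)
  show ?A using A unfolding P eA poly[OF of_nat_0_le_iff] .
  have eB: "em_tail s x - em_tail s (x + 1) - x powr (-s)
      + (pochhammer s 5 * (x powr (-s - real 5) - (x+1) powr (-s - real 5))) / 30240
     = em_tail s x + pochhammer s 5 * x powr (-s-5) / 30240
              - (em_tail s (x + 1) + pochhammer s 5 * (x + 1) powr (-s-5) / 30240) - x powr (-s)"
    by (simp add: ring_distribs add_divide_distrib diff_divide_distrib)
  show ?B using B unfolding P eA poly2[OF of_nat_0_le_iff] eB .
qed

section \<open>One-step inequalities and their telescoping\<close>

text \<open>Each difference is a series of one sign. Odd terms vanish through \<open>w\<close>,
  which is nonnegative since \<open>s > 0\<close>; the low even terms vanish through the polynomial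
  factor; from 6 on that factor is nonpositive in the first series and nonnegative in the
  second.\<close>

lemma em_bracket_step:
  fixes s x :: real
  assumes "x > 0" "s > 0" "s \<noteq> 1"
  shows "em_tail s x - em_tail s (x + 1) \<le> x powr (-s)"
    and "x powr (-s) \<le> em_tail s x + pochhammer s 5 * x powr (-s-5) / 30240
              - (em_tail s (x + 1) + pochhammer s 5 * (x + 1) powr (-s-5) / 30240)"
proof -
  define w where "w n = (1 + (-1)^n) / 2 * (pochhammer s n / fact n * (1/2)^n * (x + 1/2) powr (-s - real n))"
    for n
  have w: "w n \<ge> 0" for n
    unfolding w_def using assms by (intro mult_nonneg_nonneg divide_nonneg_pos pochhammer_nonneg)
      (auto simp: power_le_one_iff minus_one_power_iff)
  have cases: "odd n \<and> w n = 0 \<or> n = 0 \<or> n = 2 \<or> n = 4 \<or> n \<ge> 6" for n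
  proof (cases "odd n")
    case False
    then show ?thesis by presburger
  qed (auto simp: w_def)
  have "em_tail s x - em_tail s (x + 1) - x powr (-s) \<le> 0"
  proof (rule sums_le[OF _ em_tail_step_sums(1)[OF assms(1,3), folded w_def] sums_zero])
    fix n
    show "w n / (real n + 1) * (real n * (real n - 2) * (16 - (real n)\<^sup>2) / 45) \<le> 0"
    proof (cases "n \<ge> 6")
      case True
      then have "(16 - (real n)\<^sup>2) \<le> 0" using power_mono[of 6 "real n" 2] by simp
      with True w[of n] show ?thesis
        by (intro mult_nonneg_nonpos divide_nonpos_pos) auto
    qed (use cases[of n] in auto)
  qed
  then show "em_tail s x - em_tail s (x + 1) \<le> x powr (-s)" by simp
  have "0 \<le> em_tail s x + pochhammer s 5 * x powr (-s-5) / 30240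
              - (em_tail s (x + 1) + pochhammer s 5 * (x + 1) powr (-s-5) / 30240) - x powr (-s)"
  proof (rule sums_le[OF _ sums_zero em_tail_step_sums(2)[OF assms(1,3), folded w_def]])
    fix n
    show "0 \<le> w n / (real n + 1) * (real n * (real n - 2) * (real n - 4) * (real n - 6) *
           (2 * real n ^ 2 + 6 * real n + 13) / 945)"
    proof (cases "n \<ge> 6")
      case True
      with w[of n] show ?thesis by simp
    qed (use cases[of n] in auto)
  qed
  then show "x powr (-s) \<le> em_tail s x + pochhammer s 5 * x powr (-s-5) / 30240
              - (em_tail s (x + 1) + pochhammer s 5 * (x + 1) powr (-s-5) / 30240)" by simp
qed

text \<open>Both approximations tend to 0 at infinity, so the one-step inequalities
  telescope.\<close>

lemma powr_suminf_bracket: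
  fixes s :: real and N :: nat
  assumes "s > 1" "N > 0"
  shows "em_tail s N \<le> (\<Sum>n. real (n + N) powr (-s))"
    and "(\<Sum>n. real (n + N) powr (-s)) \<le> em_tail s N + pochhammer s 5 * real N powr (-s-5) / 30240"
proof -
  have summ: "summable (\<lambda>n. real (n + N) powr (-s))"
    using assms(1) summable_real_powr_iff[of "-s"] by (subst summable_iff_shift) auto
  define T where "T = (\<lambda>x. em_tail s x)"
  define U where "U = (\<lambda>x. em_tail s x + pochhammer s 5 * x powr (-s-5) / 30240)"
  have lim: "filterlim (\<lambda>n. real (n + N)) at_top sequentially"
    by (intro filterlim_compose[OF filterlim_real_sequentially]) (simp add: filterlim_add_const_nat_at_top)
  have p: "(\<lambda>n. real (n + N) powr a) \<longlonglongrightarrow> 0" if "a < 0" for a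
    using tendsto_neg_powr[OF that lim] .
  have T0: "(\<lambda>n. T (real (n + N))) \<longlonglongrightarrow> 0 / (s - 1) + 0 / 2 + s * 0 / 12 - pochhammer s 3 * 0 / 720"
    unfolding T_def em_tail_def using assms(1)
    by (intro tendsto_intros p) auto
  then have U0: "(\<lambda>n. U (real (n + N))) \<longlonglongrightarrow> 0 + pochhammer s 5 * 0 / 30240"
    unfolding U_def T_def [symmetric] using assms(1)
    by (intro tendsto_intros p) auto
  have sT: "(\<lambda>n. T (real (n + N)) - T (real (Suc n + N))) sums T N"
    using telescope_sums'[OF T0] by simp
  have sU: "(\<lambda>n. U (real (n + N)) - U (real (Suc n + N))) sums U N"
    using telescope_sums'[OF U0] by simp
  have step: "T (real (n + N)) - T (real (Suc n + N)) \<le> real (n + N) powr (-s)"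
     "real (n + N) powr (-s) \<le> U (real (n + N)) - U (real (Suc n + N))" for n
    using em_bracket_step[of "real (n + N)" s] assms
    by (simp_all add: T_def U_def add_ac)
  show "em_tail s N \<le> (\<Sum>n. real (n + N) powr (-s))"
    using sums_le[OF step(1) sT summable_sums[OF summ]] by (simp add: T_def)
  show "(\<Sum>n. real (n + N) powr (-s)) \<le> em_tail s N + pochhammer s 5 * real N powr (-s-5) / 30240"
    using sums_le[OF step(2) summable_sums[OF summ] sU] by (simp add: U_def)
qed

text \<open>The term \<open>n = 0\<close> vanishes because \<open>0 powr a = 0\<close>.\<close>
definition rzeta :: "real \<Rightarrow> real" where
  "rzeta s = (\<Sum>n. real n powr (-s))"

section \<open>Enclosures of zeta on the real axis\<close>

lemma summable_nat_powr:
  assumes "s > 1"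
  shows "summable (\<lambda>n. real n powr (-s))"
  using assms by (simp add: summable_real_powr_iff)

lemma rzeta_bracket:
  fixes s :: real and N :: nat
  assumes "s > 1" "N > 1"
  defines "L \<equiv> N / (s - 1) + 1 / 2 + s / (12 * N) - pochhammer s 3 / (720 * N ^ 3)"
  shows "rzeta s \<ge> 1 + (\<Sum>n=2..<N. real n powr (-s)) + N powr (-s) * L"
    and "rzeta s \<le> 1 + (\<Sum>n=2..<N. real n powr (-s)) + N powr (-s) * (L + pochhammer s 5 / (30240 * N ^ 5))"
proof -
  have "rzeta s = (\<Sum>n. real (n + N) powr (-s)) + (\<Sum>n<N. real n powr (-s))"
    unfolding rzeta_def by (rule suminf_split_initial_segment[OF summable_nat_powr[OF assms(1)]])
  \<comment> \<open>The summand at 0 is 0 and the one at 1 is 1; the sum then runs from 2.\<close>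
  also have "{..<N} = insert 0 (insert 1 {2..<N})" using assms(2) by auto
  finally have split: "rzeta s = 1 + (\<Sum>n=2..<N. real n powr (-s)) + (\<Sum>n. real (n + N) powr (-s))" by simp
  have p: "real N powr (-s - real k) = real N powr (-s) / real N ^ k" for k
    using assms(2) by (simp add: powr_diff powr_realpow)
  have "real N powr (1 - s) = real N powr (-s) * N"
    using assms(2) powr_add[of "real N" "-s" 1] by (simp add: add.commute)
  then have L: "em_tail s N = N powr (-s) * L"
    using p[of 1] p[of 3] assms(1,2) unfolding em_tail_def L_def
    by (simp add: ring_distribs add_divide_distrib mult_ac)
  have U: "em_tail s N + pochhammer s 5 * real N powr (-s-5) / 30240
      = N powr (-s) * (L + pochhammer s 5 / (30240 * N ^ 5))"
    using p[of 5] by (simp add: L ring_distribs mult_ac)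
  show "rzeta s \<ge> 1 + (\<Sum>n=2..<N. real n powr (-s)) + N powr (-s) * L"
    and "rzeta s \<le> 1 + (\<Sum>n=2..<N. real n powr (-s)) + N powr (-s) * (L + pochhammer s 5 / (30240 * N ^ 5))"
    using powr_suminf_bracket[of s N, unfolded U, unfolded L] assms(1,2) unfolding split by simp_all
qed

text \<open>A decimal \<open>c\<close> replaces the rational correction factor, so a numerical use
  needs only a comparison of rationals and bounds on the powers.\<close>

lemma rzeta_ge:
  fixes s c :: real and N :: nat
  assumes "s > 1" "N > 1"
    and "c \<le> N / (s - 1) + 1 / 2 + s / (12 * N) - pochhammer s 3 / (720 * N ^ 3)"
  shows "1 + (\<Sum>n=2..<N. real n powr (-s)) + N powr (-s) * c \<le> rzeta s"
  using mult_left_mono[OF assms(3), of "N powr (-s)"] rzeta_bracket(1)[OF assms(1,2)] by simp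

lemma rzeta_le:
  fixes s c :: real and N :: nat
  assumes "s > 1" "N > 1"
    and "N / (s - 1) + 1 / 2 + s / (12 * N) - pochhammer s 3 / (720 * N ^ 3)
      + pochhammer s 5 / (30240 * N ^ 5) \<le> c"
  shows "rzeta s \<le> 1 + (\<Sum>n=2..<N. real n powr (-s)) + N powr (-s) * c"
  using mult_left_mono[OF assms(3), of "N powr (-s)"] rzeta_bracket(2)[OF assms(1,2)] by simp

text \<open>At even integers all powers are rational, so both ends of the bracket can be evaluated
  exactly.\<close>

lemma rzeta_even_bracket:
  fixes k N :: nat
  assumes "k > 0" "N > 1"
  defines "L \<equiv> N / (2 * real k - 1) + 1 / 2 + 2 * real k / (12 * N) - pochhammer (2 * real k) 3 / (720 * N ^ 3)"
  shows "rzeta (2 * real k) \<in> {1 + (\<Sum>n=2..<N. 1 / real n ^ (2 * k)) + L / real N ^ (2 * k) ..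
     1 + (\<Sum>n=2..<N. 1 / real n ^ (2 * k)) + (L + pochhammer (2 * real k) 5 / (30240 * N ^ 5)) / real N ^ (2 * k)}"
proof -
  have p: "real n powr (-(2 * real k)) = 1 / real n ^ (2 * k)" if "n > 0" for n
    using that powr_realpow[of "real n" "2 * k"] by (simp add: powr_minus_divide)
  have s: "(\<Sum>n=2..<N. real n powr (-(2 * real k))) = (\<Sum>n=2..<N. 1 / real n ^ (2 * k))"
    by (intro sum.cong refl p) auto
  show ?thesis
    using rzeta_bracket[of "2 * real k" N] assms unfolding s by (simp add: p)
qed

lemma pochhammer_3_5:
  fixes a :: "'a :: comm_semiring_1"
  shows "pochhammer a 3 = a * (a + 1) * (a + 2)"
    and "pochhammer a 5 = a * (a + 1) * (a + 2) * (a + 3) * (a + 4)"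
  by (simp_all add: eval_nat_numeral pochhammer_Suc add_ac)

text \<open>The bracket has width \<open>pochhammer (2 * k) 5 / (30240 * N ^ (2 * k + 5))\<close>,
  so the cut \<open>N\<close> may shrink from 20 to 4 as the exponent grows. Arguments up to 30
  serve the terms \<open>n < 16\<close> of the split series.\<close>

lemma rzeta_even_values:
  shows "rzeta 2 \<in> {1.644934066829..1.644934066849}"
    and "rzeta 4 \<in> {1.082323233705..1.082323233712}"
    and "rzeta 6 \<in> {1.017343061974..1.017343061985}"
    and "rzeta 8 \<in> {1.004077356197..1.004077356198}"
    and "rzeta 10 \<in> {1.000994575127..1.000994575128}"
    and "rzeta 12 \<in> {1.000246086552..1.000246086554}"
    and "rzeta 14 \<in> {1.000061248135..1.000061248136}"
    and "rzeta 16 \<in> {1.000015282259..1.000015282260}"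
    and "rzeta 18 \<in> {1.000003817293..1.000003817294}"
    and "rzeta 20 \<in> {1.000000953961..1.000000953963}"
    and "rzeta 22 \<in> {1.000000238450..1.000000238451}"
    and "rzeta 24 \<in> {1.000000059608..1.000000059609}"
    and "rzeta 26 \<in> {1.000000014901..1.000000014902}"
    and "rzeta 28 \<in> {1.000000003725..1.000000003726}"
    and "rzeta 30 \<in> {1.000000000931..1.000000000932}"
  subgoal using rzeta_even_bracket[of 1 20] by (simp add: pochhammer_3_5 atLeastLessThan_nat_numeral)
  subgoal using rzeta_even_bracket[of 2 15] by (simp add: pochhammer_3_5 atLeastLessThan_nat_numeral)
  subgoal using rzeta_even_bracket[of 3 10] by (simp add: pochhammer_3_5 atLeastLessThan_nat_numeral)
  subgoal using rzeta_even_bracket[of 4 10] by (simp add: pochhammer_3_5 atLeastLessThan_nat_numeral)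
  subgoal using rzeta_even_bracket[of 5 10] by (simp add: pochhammer_3_5 atLeastLessThan_nat_numeral)
  subgoal using rzeta_even_bracket[of 6 6] by (simp add: pochhammer_3_5 atLeastLessThan_nat_numeral)
  subgoal using rzeta_even_bracket[of 7 6] by (simp add: pochhammer_3_5 atLeastLessThan_nat_numeral)
  subgoal using rzeta_even_bracket[of 8 6] by (simp add: pochhammer_3_5 atLeastLessThan_nat_numeral)
  subgoal using rzeta_even_bracket[of 9 6] by (simp add: pochhammer_3_5 atLeastLessThan_nat_numeral)
  subgoal using rzeta_even_bracket[of 10 4] by (simp add: pochhammer_3_5 atLeastLessThan_nat_numeral)
  subgoal using rzeta_even_bracket[of 11 4] by (simp add: pochhammer_3_5 atLeastLessThan_nat_numeral)
  subgoal using rzeta_even_bracket[of 12 4] by (simp add: pochhammer_3_5 atLeastLessThan_nat_numeral)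
  subgoal using rzeta_even_bracket[of 13 4] by (simp add: pochhammer_3_5 atLeastLessThan_nat_numeral)
  subgoal using rzeta_even_bracket[of 14 4] by (simp add: pochhammer_3_5 atLeastLessThan_nat_numeral)
  subgoal using rzeta_even_bracket[of 15 4] by (simp add: pochhammer_3_5 atLeastLessThan_nat_numeral)
  done

section \<open>The series D on the real axis and its non-vanishing\<close>

lemma rzeta_gt_1:
  assumes "s > 1"
  shows "rzeta s > 1"
proof -
  have "rzeta s = (\<Sum>n. real (n + 2) powr (-s)) + (\<Sum>n<2. real n powr (-s))"
    unfolding rzeta_def by (rule suminf_split_initial_segment[OF summable_nat_powr[OF assms]])
  moreover have "(\<Sum>n. real (n + 2) powr (-s)) > 0"
    using summable_ignore_initial_segment[OF summable_nat_powr[OF assms], of 2] by (intro suminf_pos) auto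
  ultimately show ?thesis by (simp add: eval_nat_numeral)
qed

lemma zeta_of_real:
  assumes "s > 1"
  shows "zeta (of_real s) = of_real (rzeta s)"
proof -
  have "((\<lambda>n. real n powr (-s)) has_sum rzeta s) UNIV"
    unfolding rzeta_def using summable_nat_powr[OF assms]
    by (intro norm_summable_imp_has_sum) (auto simp: summable_sums)
  then have "((\<lambda>n. complex_of_real (real n powr (-s))) has_sum of_real (rzeta s)) UNIV"
    by (rule has_sum_of_real)
  also have "?this \<longleftrightarrow> ((\<lambda>n. of_nat n powr (- of_real s :: complex)) has_sum of_real (rzeta s)) {1..}"
    by (rule has_sum_cong_neutral) (auto simp: powr_of_real [symmetric])
  finally show ?thesis unfolding zeta_def by (rule infsumI)
qed

lemma zeta_even:
  assumes "n > 0"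
  shows "zeta (of_nat (2 * n)) = of_real (rzeta (2 * real n))"
  using zeta_of_real[of "2 * real n"] assms by simp

text \<open>For bases at least 2, two of the \<open>2 * k\<close> powers are kept for convergence
  and the others are bounded by their value at base 2. What remains is \<open>rzeta 2 - 1\<close>,
  which is below 1 by its enclosure.\<close>

lemma rzeta_even_minus_one_le:
  assumes "k > 0"
  shows "rzeta (2 * real k) - 1 \<le> 4 * (1/4) ^ k"
proof -
  have k: "2 * real k > 1" using assms by simp
  have split: "rzeta s = 1 + (\<Sum>n. real (n + 2) powr (-s))"
    and summ: "summable (\<lambda>n. real (n + 2) powr (-s))"
    if "s > 1" for s
  proof -
    show "summable (\<lambda>n. real (n + 2) powr (-s))"
      by (rule summable_ignore_initial_segment[OF summable_nat_powr[OF that]])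
    show "rzeta s = 1 + (\<Sum>n. real (n + 2) powr (-s))"
      unfolding rzeta_def using suminf_split_initial_segment[OF summable_nat_powr[OF that], of 2]
      by (simp add: eval_nat_numeral)
  qed
  have c: "2 powr (2 - 2 * real k) = 4 * (1/4) ^ k"
  proof -
    have "2 powr (2 * real k) = (4::real) ^ k"
      using powr_realpow[of 2 "2 * k"] by (simp add: power_mult)
    then show ?thesis by (simp add: powr_diff power_divide)
  qed
  have le: "real (n + 2) powr (-(2 * real k)) \<le> 4 * (1/4) ^ k * real (n + 2) powr (-2)" for n
  proof -
    have "real (n + 2) powr (-(2 * real k)) = real (n + 2) powr (2 - 2 * real k) * real (n + 2) powr (-2)"
      by (simp add: powr_add [symmetric])
    also have "\<dots> \<le> 2 powr (2 - 2 * real k) * real (n + 2) powr (-2)"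
      using assms by (intro mult_right_mono powr_mono2') auto
    finally show ?thesis by (simp only: c)
  qed
  have "rzeta (2 * real k) - 1 \<le> (\<Sum>n. 4 * (1/4) ^ k * real (n + 2) powr (-2))"
    unfolding split[OF k] using suminf_le[OF le summ[OF k] summable_mult[OF summ[of 2]]] by simp
  also have "\<dots> = 4 * (1/4) ^ k * (rzeta 2 - 1)"
    using suminf_mult[OF summ[of 2], of "4 * (1/4) ^ k"] split[of 2] by simp
  also have "\<dots> \<le> 4 * (1/4) ^ k * 1"
    using rzeta_even_values(1) by (intro mult_left_mono) auto
  finally show ?thesis by simp
qed

lemma rrzeta_even_values:
  assumes "k > 0"
  shows "1 \<le> rzeta (2 * real k)" and "rzeta (2 * real k) \<le> 2"
proof -
  show "1 \<le> rzeta (2 * real k)" using rzeta_gt_1[of "2 * real k"] assms by simp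
  have "(1/4) ^ k \<le> (1/4::real) ^ 1" using assms by (intro power_decreasing) auto
  then show "rzeta (2 * real k) \<le> 2" using rzeta_even_minus_one_le[OF assms] by simp
qed

section \<open>The real series: convergence, monotonicity, continuity\<close>

definition dterm :: "real \<Rightarrow> nat \<Rightarrow> real" where
  "dterm s n = rzeta (2 * real n) * real n powr (-s)"

text \<open>The function called \<open>F\<close> in the opening sketch.\<close>

definition dtail :: "real \<Rightarrow> real" where
  "dtail s = (\<Sum>n. dterm s (n + 2))"

lemma dterm_bounds:
  assumes "n > 0"
  shows "real n powr (-s) \<le> dterm s n" "dterm s n \<le> 2 * real n powr (-s)"
  unfolding dterm_def using rrzeta_even_values[OF assms] by (simp_all add: mult_le_cancel_right1 mult_right_mono)

lemma dterm_0 [simp]: "dterm s 0 = 0"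
  by (simp add: dterm_def)

lemma dterm_nonneg: "dterm s n \<ge> 0"
  using order_trans[OF powr_ge_zero dterm_bounds(1), of n s] by (cases "n = 0") auto

text \<open>The terms lie between \<open>n powr (-s)\<close> and twice that, so convergence is that
  of the zeta series itself.\<close>

lemma summable_dterm_iff: "summable (dterm s) \<longleftrightarrow> s > 1"
proof
  assume summ: "summable (dterm s)"
  have "norm (real n powr (-s)) \<le> dterm s n" for n
    using dterm_bounds(1)[of n s] by (cases "n = 0") auto
  then have "summable (\<lambda>n. real n powr (-s))"
    by (rule summable_comparison_test'[OF summ])
  then show "s > 1" by (simp add: summable_real_powr_iff)
next
  assume "s > 1"
  then have summ: "summable (\<lambda>n. 2 * real n powr (-s))" by (intro summable_mult summable_nat_powr)
  have "norm (dterm s n) \<le> 2 * real n powr (-s)" if "n \<ge> 1" for n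
    using dterm_bounds(2)[of n s] dterm_nonneg[of s n] that by simp
  then show "summable (dterm s)" by (rule summable_comparison_test'[OF summ])
qed

lemma summable_dterm_shift: "s > 1 \<Longrightarrow> summable (\<lambda>n. dterm s (n + 2))"
  by (rule summable_ignore_initial_segment) (simp add: summable_dterm_iff)

lemma summand_eq_dterm:
  assumes "n > 0"
  shows "zeta (of_nat (2 * n)) * of_nat n powr (- of_real s) = of_real (dterm s n)"
proof -
  have "(of_nat n :: complex) powr (- of_real s) = of_real (real n powr (-s))"
    using powr_of_real[of "real n" "-s"] by simp
  then show ?thesis using zeta_even[OF assms] by (simp add: dterm_def)
qed

text \<open>The summands are nonnegative reals, so unordered summability agrees with ordinary
  convergence, and the indices 0 and 1 do not affect it.\<close>

lemma summable_on_summand_iff: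
  "(\<lambda>n. zeta (of_nat (2 * n)) * of_nat n powr (- of_real s)) summable_on {2..} \<longleftrightarrow> s > 1"
proof -
  have "(\<lambda>n. zeta (of_nat (2 * n)) * of_nat n powr (- of_real s)) summable_on {2..} \<longleftrightarrow>
        (\<lambda>n. complex_of_real (dterm s n)) summable_on {2..}"
    using summand_eq_dterm by (intro summable_on_cong) auto
  also have "\<dots> \<longleftrightarrow> dterm s summable_on {2..}"
    using summable_on_of_real[of "dterm s"]
      summable_on_bounded_linear[OF bounded_linear_Re, of "\<lambda>n. complex_of_real (dterm s n)"]
    by (auto simp: o_def)
  also have "\<dots> \<longleftrightarrow> dterm s summable_on UNIV"
  proof
    assume "dterm s summable_on {2..}"
    then have "dterm s summable_on ({2..} \<union> {..<2})"
      by (intro summable_on_Un_disjoint) auto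
    also have "{2..} \<union> {..<2} = (UNIV :: nat set)" by auto
    finally show "dterm s summable_on UNIV" .
  next
    assume "dterm s summable_on UNIV"
    then show "dterm s summable_on {2..}" by (rule summable_on_subset_banach) simp
  qed
  also have "\<dots> \<longleftrightarrow> s > 1"
    using summable_on_UNIV_nonneg_real_iff[of "dterm s"] dterm_nonneg summable_dterm_iff by simp
  finally show ?thesis .
qed

lemma has_sum_dtail:
  assumes "s > 1"
  shows "((\<lambda>n. zeta (of_nat (2 * n)) * of_nat n powr (- of_real s)) has_sum of_real (dtail s)) {2..}"
proof -
  have "(\<lambda>n. dterm s (n + 2)) sums dtail s"
    unfolding dtail_def by (rule summable_sums[OF summable_dterm_shift[OF assms]])
  \<comment> \<open>Padding with zeros below 2 undoes the index shift and gives a series over all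
    naturals, whose unordered sum can then be restricted.\<close>
  then have sums: "(\<lambda>n. if n < 2 then 0 else dterm s n) sums dtail s"
    using sums_zero_iff_shift[of 2 "\<lambda>n. if n < 2 then 0 else dterm s n" "dtail s"] by simp
  have "((\<lambda>n. if n < 2 then 0 else dterm s n) has_sum dtail s) UNIV"
    using sums sums_summable[OF sums] dterm_nonneg
    by (intro norm_summable_imp_has_sum) (auto simp: if_distrib cong: if_cong)
  then have "((\<lambda>n. complex_of_real (if n < 2 then 0 else dterm s n)) has_sum of_real (dtail s)) UNIV"
    by (rule has_sum_of_real)
  also have "?this \<longleftrightarrow> ?thesis"
    by (rule has_sum_cong_neutral) (auto simp: summand_eq_dterm simp del: of_nat_mult)
  finally show ?thesis .
qed

text \<open>Serves twice: for uniqueness of the root, and to carry the bound at the root to every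
  larger real part.\<close>

lemma dtail_strict_antimono:
  assumes "1 < a" "a < b"
  shows "dtail b < dtail a"
proof -
  have "dterm b (n + 2) < dterm a (n + 2)" for n
    unfolding dterm_def using assms rzeta_gt_1[of "2 * real (n + 2)"]
    by (intro mult_strict_left_mono powr_less_mono) auto
  then have "0 < (\<Sum>n. dterm a (n + 2) - dterm b (n + 2))"
    using assms by (intro suminf_pos summable_diff summable_dterm_shift) auto
  also have "\<dots> = dtail a - dtail b"
    unfolding dtail_def using assms by (intro suminf_diff [symmetric] summable_dterm_shift) auto
  finally show ?thesis by simp
qed

text \<open>Weierstrass M-test, with the terms at the left endpoint as majorant.\<close>

lemma continuous_on_dtail:
  assumes "a > 1"
  shows "continuous_on {a..b} dtail"
proof -
  have limit: "uniform_limit {a..b} (\<lambda>n s. \<Sum>i<n. dterm s (i + 2)) (\<lambda>s. \<Sum>i. dterm s (i + 2)) sequentially"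
  proof (rule Weierstrass_m_test)
    show "summable (\<lambda>n. dterm a (n + 2))" by (rule summable_dterm_shift[OF assms])
    show "norm (dterm s (n + 2)) \<le> dterm a (n + 2)" if "s \<in> {a..b}" for n s
      using that dterm_nonneg[of s "n + 2"] rrzeta_even_values(1)[of "n + 2"]
      by (simp add: dterm_def abs_mult)
  qed
  have cont: "\<forall>\<^sub>F n in sequentially. continuous_on {a..b} (\<lambda>s. \<Sum>i<n. dterm s (i + 2))"
    unfolding dterm_def by (intro always_eventually allI continuous_intros) auto
  show ?thesis unfolding dtail_def
    by (rule uniform_limit_theorem[OF cont limit]) simp
qed

section \<open>Non-vanishing from equality in the triangle inequality\<close>

text \<open>At a zero, the real parts of the terms \<open>n \<ge> 2\<close> add up to
  \<open>- rzeta 2\<close> while their norms add up to at most \<open>rzeta 2\<close>. So the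
  nonnegative quantities \<open>norm (h n) + Re (h n)\<close> have sum at most 0, and each of them
  vanishes.\<close>

lemma D_nonzero:
  assumes "a > 1" "dtail a = rzeta 2" "Re s \<ge> a"
  shows "D s \<noteq> 0"
proof
  assume "D s = 0"
  define h where "h n = zeta (of_nat (2 * n)) * of_nat n powr (- s)" for n
  have norm_h: "norm (h n) = dterm (Re s) n" for n
  proof (cases "n = 0")
    case False
    then show ?thesis
      using zeta_even[of n] rrzeta_even_values(1)[of n]
      by (simp add: h_def dterm_def norm_mult norm_powr_real_powr)
  qed (simp add: h_def)
  have summ: "summable (\<lambda>n. norm (h n))"
    using assms(1,3) by (simp add: norm_h summable_dterm_iff)
  have "(h has_sum suminf h) UNIV"
    by (rule norm_summable_imp_has_sum[OF summ summable_sums[OF summable_norm_cancel[OF summ]]])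
  also have "?this \<longleftrightarrow> (h has_sum suminf h) {1..}"
    by (rule has_sum_cong_neutral) (auto simp: h_def)
  finally have "D s = suminf h"
    unfolding D_def h_def [symmetric] by (rule infsumI)
  also have "\<dots> = (\<Sum>n. h (n + 2)) + (\<Sum>n<2. h n)"
    by (rule suminf_split_initial_segment[OF summable_norm_cancel[OF summ]])
  \<comment> \<open>The term at 0 is zero because \<open>0 powr (- s)\<close> is 0, so only
    \<open>n = 1\<close> contributes.\<close>
  also have "(\<Sum>n<2. h n) = of_real (rzeta 2)"
    using zeta_even[of 1] by (simp add: h_def eval_nat_numeral)
  finally have h_sum: "(\<Sum>n. h (n + 2)) = - of_real (rzeta 2)"
    using \<open>D s = 0\<close> by (simp add: add_eq_0_iff)
  have summ2: "summable (\<lambda>n. norm (h (n + 2)))" "summable (\<lambda>n. h (n + 2))"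
    using summable_ignore_initial_segment[OF summ, of 2]
      summable_ignore_initial_segment[OF summable_norm_cancel[OF summ], of 2] by auto
  then have summ_Re: "summable (\<lambda>n. Re (h (n + 2)))" by (simp add: summable_Re)
  have "dtail (Re s) \<le> rzeta 2"
    using dtail_strict_antimono[of a "Re s"] assms by (cases "Re s = a") auto
  then have "(\<Sum>n. norm (h (n + 2))) + (\<Sum>n. Re (h (n + 2))) \<le> 0"
    using h_sum Re_suminf[OF summ2(2)] by (simp add: norm_h dtail_def)
  then have "(\<Sum>n. norm (h (n + 2)) + Re (h (n + 2))) \<le> 0"
    using suminf_add[OF summ2(1) summ_Re] by simp
  moreover have nonneg: "norm (h n) + Re (h n) \<ge> 0" for n
    using abs_Re_le_cmod[of "h n"] by linarith
  ultimately have "norm (h (n + 2)) + Re (h (n + 2)) = 0" for n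
    using suminf_nonneg[OF summable_add[OF summ2(1) summ_Re] nonneg]
      suminf_eq_zero_iff[OF summable_add[OF summ2(1) summ_Re] nonneg] by simp
  \<comment> \<open>Positions 0 and 2 of the shifted series are \<open>n = 2\<close> and
    \<open>n = 4\<close>.\<close>
  from this[of 0] this[of 2] have Re_h: "Re (h 2) = - norm (h 2)" "Re (h 4) = - norm (h 4)"
    by (simp_all add: eval_nat_numeral)
  have aligned: "of_nat n powr (-s) = - complex_of_real (real n powr (- Re s))"
    if "n > 0" and Re: "Re (h n) = - norm (h n)" for n
  proof -
    define z where "z = (of_nat n :: complex) powr (-s)"
    have "norm z = real n powr (- Re s)"
      unfolding z_def using that(1) by (simp add: norm_powr_real_powr)
    moreover have "h n = of_real (rzeta (2 * real n)) * z" unfolding h_def z_def zeta_even[OF that(1)] ..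
    moreover have "rzeta (2 * real n) > 0" using rrzeta_even_values(1)[OF that(1)] by simp
    ultimately have "rzeta (2 * real n) * Re z = rzeta (2 * real n) * (- norm z)" "rzeta (2 * real n) \<noteq> 0"
      using Re by (auto simp: norm_mult)
    then have "Re z = - norm z" using mult_left_cancel by blast
    moreover from this have "Im z = 0" using cmod_power2[of z] by simp
    ultimately show ?thesis using \<open>norm z = real n powr (- Re s)\<close>
      unfolding z_def [symmetric] by (simp add: complex_eq_iff)
  qed
  \<comment> \<open>Both powers would be negative reals, yet the one of 4 is the square of the one
    of 2 and hence positive.\<close>
  have "(4::complex) powr (-s) = 2 powr (-s) * 2 powr (-s)"
    using powr_times_real[of 2 2 "-s"] by simp
  then have "- complex_of_real (4 powr (- Re s)) = complex_of_real (2 powr (- Re s) * 2 powr (- Re s))"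
    using aligned[of 2] aligned[of 4] Re_h by simp
  then have "- (4 powr (- Re s)) = 2 powr (- Re s) * 2 powr (- Re s)"
    unfolding of_real_minus [symmetric] of_real_eq_iff .
  moreover have "4 powr (- Re s) > 0" "2 powr (- Re s) * 2 powr (- Re s) > 0" by simp_all
  ultimately show False by linarith
qed

text \<open>
  Since \<open>\<zeta>(2n) - 1\<close> decays like \<open>4 powr -n\<close>, subtracting \<open>\<zeta>\<close> leaves a rapidly converging series.
\<close>
lemma dtail_split:
  assumes "s > 1"
  defines "P \<equiv> rzeta s - 1 + (\<Sum>n=2..<16. (rzeta (2 * real n) - 1) * real n powr (-s))"
  shows "P \<le> dtail s" and "dtail s \<le> P + (1/4) ^ 14 / 3"
proof -
  define e where "e n = (rzeta (2 * real n) - 1) * real n powr (-s)" for n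
  have e_nonneg: "0 \<le> e n" if "n > 0" for n
    unfolding e_def using rrzeta_even_values(1)[OF that] by simp
  have e_le: "e n \<le> 4 * (1/4) ^ n" if "n > 0" for n
  proof -
    have "real n powr (-s) \<le> real n powr 0"
      using that assms(1) by (intro powr_mono) auto
    then have "e n \<le> (rzeta (2 * real n) - 1) * 1"
      unfolding e_def using rrzeta_even_values(1)[OF that] that by (intro mult_left_mono) auto
    with rzeta_even_minus_one_le[OF that] show ?thesis by simp
  qed
  have geom: "summable (\<lambda>n. 4 * (1/4::real) ^ n)" by (intro summable_mult summable_geometric) simp
  have "summable e"
    by (rule summable_comparison_test'[OF geom, of 1]) (use e_le e_nonneg in auto)
  then have se: "summable (\<lambda>n. e (n + k))" for k by (rule summable_ignore_initial_segment)
  have sp: "summable (\<lambda>n. real (n + 2) powr (-s))"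
    by (rule summable_ignore_initial_segment[OF summable_nat_powr[OF assms(1)]])
  have "dterm s n = real n powr (-s) + e n" for n by (simp add: dterm_def e_def algebra_simps)
  then have "dtail s = (\<Sum>n. real (n + 2) powr (-s)) + (\<Sum>n. e (n + 2))"
    unfolding dtail_def using suminf_add[OF sp se[of 2]] by simp
  also have "(\<Sum>n. real (n + 2) powr (-s)) = rzeta s - 1"
    unfolding rzeta_def using suminf_split_initial_segment[OF summable_nat_powr[OF assms(1)], of 2]
    by (simp add: eval_nat_numeral)
  also have "(\<Sum>n. e (n + 2)) = (\<Sum>n. e (n + 16)) + (\<Sum>n<14. e (n + 2))"
    using suminf_split_initial_segment[OF se[of 2], of 14] by (simp add: add.commute)
  also have "(\<Sum>n<14. e (n + 2)) = (\<Sum>n=2..<16. e n)"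
    using sum.shift_bounds_nat_ivl[of e 0 2 14] by (simp add: lessThan_atLeast0 numeral_2_eq_2)
  finally have eq: "dtail s = P + (\<Sum>n. e (n + 16))" by (simp add: P_def e_def)
  then show "P \<le> dtail s" using suminf_nonneg[OF se[of 16]] e_nonneg by simp
  \<comment> \<open>Geometric majorant of the remainder: its sum is about 1.2e-9, still below the
    gap of about 2.5e-9 at the upper end of the root interval.\<close>
  have "(\<Sum>n. e (n + 16)) \<le> (\<Sum>n. 4 * (1/4) ^ 16 * (1/4::real) ^ n)"
  proof (rule suminf_le[OF _ se])
    show "e (n + 16) \<le> 4 * (1/4) ^ 16 * (1/4::real) ^ n" for n
      using e_le[of "n + 16"] by (simp add: power_add mult_ac)
    show "summable (\<lambda>n. 4 * (1/4) ^ 16 * (1/4::real) ^ n)"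
      by (intro summable_mult summable_geometric) simp
  qed
  also have "\<dots> = 4 * (1/4) ^ 16 * (1 / (1 - 1/4))"
    by (subst suminf_mult, simp add: summable_geometric, subst suminf_geometric) simp_all
  also have "\<dots> = (1/4) ^ 14 / 3" by (simp add: power_divide)
  finally show "dtail s \<le> P + (1/4) ^ 14 / 3" using eq by simp
qed

section \<open>Numerical enclosures\<close>

text \<open>The hypothesis \<open>r ^ 2 * p ^ 3 \<le> 1\<close> certifies \<open>r\<close> as a
  lower bound for \<open>p powr (-3/2)\<close> by rational arithmetic. The exponential is cut after
  the cubic term, where the Lagrange remainder has even order and is nonnegative.\<close>

lemma powr_neg_lower:
  fixes p s U r :: real
  assumes "p > 0" "ln p \<le> U" "s \<ge> 3/2" "r \<ge> 0" "r ^ 2 * p ^ 3 \<le> 1"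
  defines "y \<equiv> (s - 3/2) * U"
  shows "r * (1 - y + y ^ 2 / 2 - y ^ 3 / 6) \<le> p powr (-s)"
proof -
  obtain t where t: "exp (-y) = (\<Sum>m<4. (-y) ^ m / fact m) + exp t / fact 4 * (-y) ^ 4"
    using Maclaurin_exp_le[of "-y" 4] by blast
  have "0 \<le> exp t / fact 4 * (-y) ^ 4" by simp
  moreover have "(\<Sum>m<4. (-y) ^ m / fact m) = 1 - y + y ^ 2 / 2 - y ^ 3 / 6"
    by (simp add: eval_nat_numeral)
  ultimately have "1 - y + y ^ 2 / 2 - y ^ 3 / 6 \<le> exp (-y)"
    unfolding t by linarith
  also have "\<dots> \<le> exp (-((s - 3/2) * ln p))"
    unfolding y_def using assms(2,3) by (simp add: mult_left_mono)
  also have "\<dots> = p powr (3/2 - s)" using assms(1) by (simp add: powr_def left_diff_distrib)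
  finally have 1: "1 - y + y ^ 2 / 2 - y ^ 3 / 6 \<le> p powr (3/2 - s)" .
  have sq: "(p powr (3/2)) ^ 2 = p ^ 3"
    using assms(1) powr_realpow[of p 3] by (simp add: powr_power)
  have "(r * p powr (3/2)) ^ 2 \<le> 1 ^ 2"
    using assms(5) by (simp add: power_mult_distrib sq)
  then have "r * p powr (3/2) \<le> 1" by (rule power2_le_imp_le) simp
  then have 2: "r \<le> p powr (-(3/2))"
    using assms(1) by (simp add: powr_minus field_simps)
  have "r * (1 - y + y ^ 2 / 2 - y ^ 3 / 6) \<le> r * p powr (3/2 - s)"
    by (intro mult_left_mono 1 assms)
  also have "\<dots> \<le> p powr (-(3/2)) * p powr (3/2 - s)"
    by (intro mult_right_mono 2) simp
  also have "\<dots> = p powr (-s)" by (simp add: powr_add [symmetric])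
  finally show ?thesis .
qed

text \<open>Here the exponential is cut after the quadratic term: the remainder has odd order in
  \<open>-y\<close>, and \<open>y \<ge> 0\<close> makes it nonpositive.\<close>

lemma powr_neg_upper:
  fixes p s U r :: real
  assumes "p > 0" "L \<le> ln p" "s \<ge> 3/2" "L \<ge> 0" "r \<ge> 0" "r ^ 2 * p ^ 3 \<ge> 1"
  defines "y \<equiv> (s - 3/2) * L"
  shows "p powr (-s) \<le> r * (1 - y + y ^ 2 / 2)"
proof -
  have y: "y \<ge> 0" using assms by simp
  obtain t where t: "exp (-y) = (\<Sum>m<3. (-y) ^ m / fact m) + exp t / fact 3 * (-y) ^ 3"
    using Maclaurin_exp_le[of "-y" 3] by blast
  have "p powr (3/2 - s) = exp (-((s - 3/2) * ln p))" using assms(1) by (simp add: powr_def left_diff_distrib)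
  also have "\<dots> \<le> exp (-y)"
    unfolding y_def using assms(2,3) by (simp add: mult_left_mono)
  also have "\<dots> \<le> 1 - y + y ^ 2 / 2"
    unfolding t using y by (simp add: eval_nat_numeral)
  finally have 1: "p powr (3/2 - s) \<le> 1 - y + y ^ 2 / 2" .
  have sq: "(p powr (3/2)) ^ 2 = p ^ 3"
    using assms(1) powr_realpow[of p 3] by (simp add: powr_power)
  have "1 ^ 2 \<le> (r * p powr (3/2)) ^ 2"
    using assms(6) by (simp add: power_mult_distrib sq)
  then have "1 \<le> r * p powr (3/2)" by (rule power2_le_imp_le) (use assms in simp)
  then have 2: "p powr (-(3/2)) \<le> r"
    using assms(1) by (simp add: powr_minus field_simps)
  have "p powr (-s) = p powr (-(3/2)) * p powr (3/2 - s)" by (simp add: powr_add [symmetric])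
  also have "\<dots> \<le> r * p powr (3/2 - s)"
    by (intro mult_right_mono 2) simp
  also have "\<dots> \<le> r * (1 - y + y ^ 2 / 2)"
    by (intro mult_left_mono 1 assms)
  finally show ?thesis .
qed

section \<open>Logarithms of the primes up to 19\<close>

text \<open>Each quotient brings in one new prime and, after 2, is chosen close to 1; the number of
  series terms needed drops from 9 to 3.\<close>

lemma ln_ratio_bounds:
  shows "ln (2::real) \<in> {0.693147179..0.693147182}"
    and "ln (3/2::real) \<in> {0.405465107..0.405465110}"
    and "ln (5/4::real) \<in> {0.223143550..0.223143553}"
    and "ln (8/7::real) \<in> {0.133531391..0.133531394}"
    and "ln (11/10::real) \<in> {0.095310178..0.095310181}"
    and "ln (13/12::real) \<in> {0.080042706..0.080042709}"
    and "ln (17/16::real) \<in> {0.060624620..0.060624623}"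
    and "ln (19/18::real) \<in> {0.054067220..0.054067223}"
  subgoal using ln_approx_bounds[of "2" 9] by (simp add: lessThan_nat_numeral lessThan_Suc power_divide)
  subgoal using ln_approx_bounds[of "3/2" 6] by (simp add: lessThan_nat_numeral lessThan_Suc power_divide)
  subgoal using ln_approx_bounds[of "5/4" 5] by (simp add: lessThan_nat_numeral lessThan_Suc power_divide)
  subgoal using ln_approx_bounds[of "8/7" 4] by (simp add: lessThan_nat_numeral lessThan_Suc power_divide)
  subgoal using ln_approx_bounds[of "11/10" 3] by (simp add: lessThan_nat_numeral lessThan_Suc power_divide)
  subgoal using ln_approx_bounds[of "13/12" 3] by (simp add: lessThan_nat_numeral lessThan_Suc power_divide)
  subgoal using ln_approx_bounds[of "17/16" 3] by (simp add: lessThan_nat_numeral lessThan_Suc power_divide)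
  subgoal using ln_approx_bounds[of "19/18" 3] by (simp add: lessThan_nat_numeral lessThan_Suc power_divide)
  done

text \<open>Linear arithmetic on the quotients: the other number in each quotient factors over
  primes already treated. The widths of the intervals add up along the way.\<close>

lemma ln_prime_bounds:
  shows "ln (2::real) \<in> {0.693147179..0.693147182}"
    and "ln (3::real) \<in> {1.098612286..1.098612292}"
    and "ln (5::real) \<in> {1.609437908..1.609437917}"
    and "ln (7::real) \<in> {1.945910143..1.945910155}"
    and "ln (11::real) \<in> {2.397895265..2.397895280}"
    and "ln (13::real) \<in> {2.564949350..2.564949365}"
    and "ln (17::real) \<in> {2.833213336..2.833213351}"
    and "ln (19::real) \<in> {2.944438971..2.944438989}"
proof -
  have powers: "ln (4::real) = 2 * ln 2" "ln (8::real) = 3 * ln 2"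
      "ln (16::real) = 4 * ln 2" "ln (9::real) = 2 * ln 3"
    using ln_realpow[of 2 2] ln_realpow[of 2 3] ln_realpow[of 2 4] ln_realpow[of 3 2] by simp_all
  have products: "ln (10::real) = ln 2 + ln 5" "ln (12::real) = ln 4 + ln 3" "ln (18::real) = ln 2 + ln 9"
    using ln_mult_pos[of 2 5] ln_mult_pos[of 4 3] ln_mult_pos[of 2 9] by simp_all
  note quotients = ln_divide_pos[of 3 2] ln_divide_pos[of 5 4] ln_divide_pos[of 8 7] ln_divide_pos[of 11 10]
    ln_divide_pos[of 13 12] ln_divide_pos[of 17 16] ln_divide_pos[of 19 18]
  show "ln (2::real) \<in> {0.693147179..0.693147182}"
    using ln_ratio_bounds powers products quotients by simp
  show "ln (3::real) \<in> {1.098612286..1.098612292}"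
    using ln_ratio_bounds powers products quotients by simp
  show "ln (5::real) \<in> {1.609437908..1.609437917}"
    using ln_ratio_bounds powers products quotients by simp
  show "ln (7::real) \<in> {1.945910143..1.945910155}"
    using ln_ratio_bounds powers products quotients by simp
  show "ln (11::real) \<in> {2.397895265..2.397895280}"
    using ln_ratio_bounds powers products quotients by simp
  show "ln (13::real) \<in> {2.564949350..2.564949365}"
    using ln_ratio_bounds powers products quotients by simp
  show "ln (17::real) \<in> {2.833213336..2.833213351}"
    using ln_ratio_bounds powers products quotients by simp
  show "ln (19::real) \<in> {2.944438971..2.944438989}"
    using ln_ratio_bounds powers products quotients by simp
qed

section \<open>Numerical powers of the integers from 2 to 20\<close>

text \<open>Only primes need the exponential estimate; composites follow by multiplying bounds. The
  range ends at 20, the cut used for \<open>rzeta\<close> near 3/2.\<close>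

lemma powr_lower_bounds:
  shows "0.353522160948 \<le> (2::real) powr (-1.500127440)"
    and "0.192423147227 \<le> (3::real) powr (-1.500127440)"
    and "0.124977918281 \<le> (4::real) powr (-1.500127440)"
    and "0.089424375674 \<le> (5::real) powr (-1.500127440)"
    and "0.068025846824 \<le> (6::real) powr (-1.500127440)"
    and "0.053981536347 \<le> (7::real) powr (-1.500127440)"
    and "0.044182463741 \<le> (8::real) powr (-1.500127440)"
    and "0.037026667588 \<le> (9::real) powr (-1.500127440)"
    and "0.031613498529 \<le> (10::real) powr (-1.500127440)"
    and "0.027401747315 \<le> (11::real) powr (-1.500127440)"
    and "0.024048644369 \<le> (12::real) powr (-1.500127440)"
    and "0.021327650270 \<le> (13::real) powr (-1.500127440)"
    and "0.019083669380 \<le> (14::real) powr (-1.500127440)"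
    and "0.017207319806 \<le> (15::real) powr (-1.500127440)"
    and "0.015619480057 \<le> (16::real) powr (-1.500127440)"
    and "0.014261651164 \<le> (17::real) powr (-1.500127440)"
    and "0.013089747538 \<le> (18::real) powr (-1.500127440)"
    and "0.012069982327 \<le> (19::real) powr (-1.500127440)"
    and "0.011176072315 \<le> (20::real) powr (-1.500127440)"
proof -
  \<comment> \<open>The last decimal is \<open>2 powr (-3/2)\<close> rounded down to 14 places, and
    the logarithm is replaced by its upper bound. The other primes follow the same pattern.\<close>
  show 2: "0.353522160948 \<le> (2::real) powr (-1.500127440)"
    by (rule order_trans[OF _ powr_neg_lower[of "2" "0.693147182" "1.500127440" "0.35355339059327"]])
       (use ln_prime_bounds in \<open>simp_all add: power2_eq_square power3_eq_cube\<close>)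
  show 3: "0.192423147227 \<le> (3::real) powr (-1.500127440)"
    by (rule order_trans[OF _ powr_neg_lower[of "3" "1.098612292" "1.500127440" "0.19245008972987"]])
       (use ln_prime_bounds in \<open>simp_all add: power2_eq_square power3_eq_cube\<close>)
  show 5: "0.089424375674 \<le> (5::real) powr (-1.500127440)"
    by (rule order_trans[OF _ powr_neg_lower[of "5" "1.609437917" "1.500127440" "0.08944271909999"]])
       (use ln_prime_bounds in \<open>simp_all add: power2_eq_square power3_eq_cube\<close>)
  show 7: "0.053981536347 \<le> (7::real) powr (-1.500127440)"
    by (rule order_trans[OF _ powr_neg_lower[of "7" "1.945910155" "1.500127440" "0.05399492471560"]])
       (use ln_prime_bounds in \<open>simp_all add: power2_eq_square power3_eq_cube\<close>)
  show 11: "0.027401747315 \<le> (11::real) powr (-1.500127440)"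
    by (rule order_trans[OF _ powr_neg_lower[of "11" "2.397895280" "1.500127440" "0.02741012223434"]])
       (use ln_prime_bounds in \<open>simp_all add: power2_eq_square power3_eq_cube\<close>)
  show 13: "0.021327650270 \<le> (13::real) powr (-1.500127440)"
    by (rule order_trans[OF _ powr_neg_lower[of "13" "2.564949365" "1.500127440" "0.02133462293173"]])
       (use ln_prime_bounds in \<open>simp_all add: power2_eq_square power3_eq_cube\<close>)
  show 17: "0.014261651164 \<le> (17::real) powr (-1.500127440)"
    by (rule order_trans[OF _ powr_neg_lower[of "17" "2.833213351" "1.500127440" "0.01426680147272"]])
       (use ln_prime_bounds in \<open>simp_all add: power2_eq_square power3_eq_cube\<close>)
  show 19: "0.012069982327 \<le> (19::real) powr (-1.500127440)"
    by (rule order_trans[OF _ powr_neg_lower[of "19" "2.944438989" "1.500127440" "0.01207451230897"]])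
       (use ln_prime_bounds in \<open>simp_all add: power2_eq_square power3_eq_cube\<close>)
  show 4: "0.124977918281 \<le> (4::real) powr (-1.500127440)"
    using mult_mono[OF 2 2] powr_mult[of 2 2 "(-1.500127440)"] by simp
  show 6: "0.068025846824 \<le> (6::real) powr (-1.500127440)"
    using mult_mono[OF 2 3] powr_mult[of 2 3 "(-1.500127440)"] by simp
  show 8: "0.044182463741 \<le> (8::real) powr (-1.500127440)"
    using mult_mono[OF 2 4] powr_mult[of 2 4 "(-1.500127440)"] by simp
  show 9: "0.037026667588 \<le> (9::real) powr (-1.500127440)"
    using mult_mono[OF 3 3] powr_mult[of 3 3 "(-1.500127440)"] by simp
  show 10: "0.031613498529 \<le> (10::real) powr (-1.500127440)"
    using mult_mono[OF 2 5] powr_mult[of 2 5 "(-1.500127440)"] by simp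
  show 12: "0.024048644369 \<le> (12::real) powr (-1.500127440)"
    using mult_mono[OF 3 4] powr_mult[of 3 4 "(-1.500127440)"] by simp
  show 14: "0.019083669380 \<le> (14::real) powr (-1.500127440)"
    using mult_mono[OF 2 7] powr_mult[of 2 7 "(-1.500127440)"] by simp
  show 15: "0.017207319806 \<le> (15::real) powr (-1.500127440)"
    using mult_mono[OF 3 5] powr_mult[of 3 5 "(-1.500127440)"] by simp
  show 16: "0.015619480057 \<le> (16::real) powr (-1.500127440)"
    using mult_mono[OF 4 4] powr_mult[of 4 4 "(-1.500127440)"] by simp
  show 18: "0.013089747538 \<le> (18::real) powr (-1.500127440)"
    using mult_mono[OF 2 9] powr_mult[of 2 9 "(-1.500127440)"] by simp
  show 20: "0.011176072315 \<le> (20::real) powr (-1.500127440)"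
    using mult_mono[OF 4 5] powr_mult[of 4 5 "(-1.500127440)"] by simp
qed

lemma powr_upper_bounds:
  shows "(2::real) powr (-1.500127441) \<le> 0.353522160704"
    and "(3::real) powr (-1.500127441) \<le> 0.192423147017"
    and "(4::real) powr (-1.500127441) \<le> 0.124977918109"
    and "(5::real) powr (-1.500127441) \<le> 0.089424375531"
    and "(6::real) powr (-1.500127441) \<le> 0.068025846703"
    and "(7::real) powr (-1.500127441) \<le> 0.053981536243"
    and "(8::real) powr (-1.500127441) \<le> 0.044182463651"
    and "(9::real) powr (-1.500127441) \<le> 0.037026667508"
    and "(10::real) powr (-1.500127441) \<le> 0.031613498458"
    and "(11::real) powr (-1.500127441) \<le> 0.027401747251"
    and "(12::real) powr (-1.500127441) \<le> 0.024048644311"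
    and "(13::real) powr (-1.500127441) \<le> 0.021327650217"
    and "(14::real) powr (-1.500127441) \<le> 0.019083669331"
    and "(15::real) powr (-1.500127441) \<le> 0.017207319760"
    and "(16::real) powr (-1.500127441) \<le> 0.015619480015"
    and "(17::real) powr (-1.500127441) \<le> 0.014261651124"
    and "(18::real) powr (-1.500127441) \<le> 0.013089747502"
    and "(19::real) powr (-1.500127441) \<le> 0.012069982292"
    and "(20::real) powr (-1.500127441) \<le> 0.011176072283"
proof -
  \<comment> \<open>All roundings are reversed: the lower bound for the logarithm, and
    \<open>2 powr (-3/2)\<close> rounded up.\<close>
  show 2: "(2::real) powr (-1.500127441) \<le> 0.353522160704"
    by (rule order_trans[OF powr_neg_upper[of "2" "0.693147179" "1.500127441" "0.35355339059328"]])
       (use ln_prime_bounds in \<open>simp_all add: power2_eq_square power3_eq_cube\<close>)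
  show 3: "(3::real) powr (-1.500127441) \<le> 0.192423147017"
    by (rule order_trans[OF powr_neg_upper[of "3" "1.098612286" "1.500127441" "0.19245008972988"]])
       (use ln_prime_bounds in \<open>simp_all add: power2_eq_square power3_eq_cube\<close>)
  show 5: "(5::real) powr (-1.500127441) \<le> 0.089424375531"
    by (rule order_trans[OF powr_neg_upper[of "5" "1.609437908" "1.500127441" "0.08944271910000"]])
       (use ln_prime_bounds in \<open>simp_all add: power2_eq_square power3_eq_cube\<close>)
  show 7: "(7::real) powr (-1.500127441) \<le> 0.053981536243"
    by (rule order_trans[OF powr_neg_upper[of "7" "1.945910143" "1.500127441" "0.05399492471561"]])
       (use ln_prime_bounds in \<open>simp_all add: power2_eq_square power3_eq_cube\<close>)
  show 11: "(11::real) powr (-1.500127441) \<le> 0.027401747251"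
    by (rule order_trans[OF powr_neg_upper[of "11" "2.397895265" "1.500127441" "0.02741012223435"]])
       (use ln_prime_bounds in \<open>simp_all add: power2_eq_square power3_eq_cube\<close>)
  show 13: "(13::real) powr (-1.500127441) \<le> 0.021327650217"
    by (rule order_trans[OF powr_neg_upper[of "13" "2.564949350" "1.500127441" "0.02133462293174"]])
       (use ln_prime_bounds in \<open>simp_all add: power2_eq_square power3_eq_cube\<close>)
  show 17: "(17::real) powr (-1.500127441) \<le> 0.014261651124"
    by (rule order_trans[OF powr_neg_upper[of "17" "2.833213336" "1.500127441" "0.01426680147273"]])
       (use ln_prime_bounds in \<open>simp_all add: power2_eq_square power3_eq_cube\<close>)
  show 19: "(19::real) powr (-1.500127441) \<le> 0.012069982292"
    by (rule order_trans[OF powr_neg_upper[of "19" "2.944438971" "1.500127441" "0.01207451230898"]])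
       (use ln_prime_bounds in \<open>simp_all add: power2_eq_square power3_eq_cube\<close>)
  show 4: "(4::real) powr (-1.500127441) \<le> 0.124977918109"
    using mult_mono[OF 2 2] powr_mult[of 2 2 "(-1.500127441)"] by simp
  show 6: "(6::real) powr (-1.500127441) \<le> 0.068025846703"
    using mult_mono[OF 2 3] powr_mult[of 2 3 "(-1.500127441)"] by simp
  show 8: "(8::real) powr (-1.500127441) \<le> 0.044182463651"
    using mult_mono[OF 2 4] powr_mult[of 2 4 "(-1.500127441)"] by simp
  show 9: "(9::real) powr (-1.500127441) \<le> 0.037026667508"
    using mult_mono[OF 3 3] powr_mult[of 3 3 "(-1.500127441)"] by simp
  show 10: "(10::real) powr (-1.500127441) \<le> 0.031613498458"
    using mult_mono[OF 2 5] powr_mult[of 2 5 "(-1.500127441)"] by simp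
  show 12: "(12::real) powr (-1.500127441) \<le> 0.024048644311"
    using mult_mono[OF 3 4] powr_mult[of 3 4 "(-1.500127441)"] by simp
  show 14: "(14::real) powr (-1.500127441) \<le> 0.019083669331"
    using mult_mono[OF 2 7] powr_mult[of 2 7 "(-1.500127441)"] by simp
  show 15: "(15::real) powr (-1.500127441) \<le> 0.017207319760"
    using mult_mono[OF 3 5] powr_mult[of 3 5 "(-1.500127441)"] by simp
  show 16: "(16::real) powr (-1.500127441) \<le> 0.015619480015"
    using mult_mono[OF 4 4] powr_mult[of 4 4 "(-1.500127441)"] by simp
  show 18: "(18::real) powr (-1.500127441) \<le> 0.013089747502"
    using mult_mono[OF 2 9] powr_mult[of 2 9 "(-1.500127441)"] by simp
  show 20: "(20::real) powr (-1.500127441) \<le> 0.011176072283"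
    using mult_mono[OF 4 5] powr_mult[of 4 5 "(-1.500127441)"] by simp
qed

section \<open>Signs at the two ends of the root interval\<close>

lemma rzeta_lower: "2.611874353799 \<le> rzeta 1.500127440"
proof -
  define s :: real where "s = 1.500127440"
  \<comment> \<open>The decimal lies just below the Euler-Maclaurin factor for
    \<open>N = 20\<close>.\<close>
  have "1 + (\<Sum>n=2..<20. real n powr (-s)) + real 20 powr (-s) * 40.49605564985 \<le> rzeta s"
    by (rule rzeta_ge) (simp_all add: pochhammer_3_5 s_def)
  then show ?thesis
    unfolding s_def [symmetric] using powr_lower_bounds[folded s_def]
    by (simp add: atLeastLessThan_nat_numeral)
qed

lemma rzeta_upper: "rzeta 1.500127441 \<le> 2.611874349991"
proof -
  define s :: real where "s = 1.500127441"
  \<comment> \<open>The decimal lies just above the factor that includes the B_6 correction.\<close>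
  have "rzeta s \<le> 1 + (\<Sum>n=2..<20. real n powr (-s)) + real 20 powr (-s) * 40.49605557326"
    by (rule rzeta_le) (simp_all add: pochhammer_3_5 s_def)
  then show ?thesis
    unfolding s_def [symmetric] using powr_upper_bounds[folded s_def]
    by (simp add: atLeastLessThan_nat_numeral)
qed

text \<open>The terms of the subtracted series beyond 15 are nonnegative and dropped; the others are
  bounded below factor by factor.\<close>

lemma dtail_lower: "rzeta 2 \<le> dtail 1.500127440"
proof -
  define s :: real where "s = 1.500127440"
  note low = powr_lower_bounds[folded s_def]
  have p2: "0.082323233705 * 0.353522160948 \<le> (rzeta 4 - 1) * 2 powr (-s)"
    using rzeta_even_values(2) low(1) by (intro mult_mono) auto
  have p3: "0.017343061974 * 0.192423147227 \<le> (rzeta 6 - 1) * 3 powr (-s)"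
    using rzeta_even_values(3) low(2) by (intro mult_mono) auto
  have p4: "0.004077356197 * 0.124977918281 \<le> (rzeta 8 - 1) * 4 powr (-s)"
    using rzeta_even_values(4) low(3) by (intro mult_mono) auto
  have p5: "0.000994575127 * 0.089424375674 \<le> (rzeta 10 - 1) * 5 powr (-s)"
    using rzeta_even_values(5) low(4) by (intro mult_mono) auto
  have p6: "0.000246086552 * 0.068025846824 \<le> (rzeta 12 - 1) * 6 powr (-s)"
    using rzeta_even_values(6) low(5) by (intro mult_mono) auto
  have p7: "0.000061248135 * 0.053981536347 \<le> (rzeta 14 - 1) * 7 powr (-s)"
    using rzeta_even_values(7) low(6) by (intro mult_mono) auto
  have p8: "0.000015282259 * 0.044182463741 \<le> (rzeta 16 - 1) * 8 powr (-s)"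
    using rzeta_even_values(8) low(7) by (intro mult_mono) auto
  have p9: "0.000003817293 * 0.037026667588 \<le> (rzeta 18 - 1) * 9 powr (-s)"
    using rzeta_even_values(9) low(8) by (intro mult_mono) auto
  have p10: "0.000000953961 * 0.031613498529 \<le> (rzeta 20 - 1) * 10 powr (-s)"
    using rzeta_even_values(10) low(9) by (intro mult_mono) auto
  have p11: "0.000000238450 * 0.027401747315 \<le> (rzeta 22 - 1) * 11 powr (-s)"
    using rzeta_even_values(11) low(10) by (intro mult_mono) auto
  have p12: "0.000000059608 * 0.024048644369 \<le> (rzeta 24 - 1) * 12 powr (-s)"
    using rzeta_even_values(12) low(11) by (intro mult_mono) auto
  have p13: "0.000000014901 * 0.021327650270 \<le> (rzeta 26 - 1) * 13 powr (-s)"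
    using rzeta_even_values(13) low(12) by (intro mult_mono) auto
  have p14: "0.000000003725 * 0.019083669380 \<le> (rzeta 28 - 1) * 14 powr (-s)"
    using rzeta_even_values(14) low(13) by (intro mult_mono) auto
  have p15: "0.000000000931 * 0.017207319806 \<le> (rzeta 30 - 1) * 15 powr (-s)"
    using rzeta_even_values(15) low(14) by (intro mult_mono) auto
  have "s > 1" by (simp add: s_def)
  show ?thesis
    unfolding s_def [symmetric]
    using dtail_split(1)[OF \<open>s > 1\<close>] rzeta_lower[folded s_def]
      p2 p3 p4 p5 p6 p7 p8 p9 p10 p11 p12 p13 p14 p15 rzeta_even_values(1)
    by (simp add: atLeastLessThan_nat_numeral)
qed

text \<open>As for the lower end, except that the geometric remainder must now be added.\<close>

lemma dtail_upper: "dtail 1.500127441 < rzeta 2"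
proof -
  define s :: real where "s = 1.500127441"
  note upp = powr_upper_bounds[folded s_def]
  have p2: "(rzeta 4 - 1) * 2 powr (-s) \<le> 0.082323233712 * 0.353522160704"
    using rzeta_even_values(2) upp(1) by (intro mult_mono) auto
  have p3: "(rzeta 6 - 1) * 3 powr (-s) \<le> 0.017343061985 * 0.192423147017"
    using rzeta_even_values(3) upp(2) by (intro mult_mono) auto
  have p4: "(rzeta 8 - 1) * 4 powr (-s) \<le> 0.004077356198 * 0.124977918109"
    using rzeta_even_values(4) upp(3) by (intro mult_mono) auto
  have p5: "(rzeta 10 - 1) * 5 powr (-s) \<le> 0.000994575128 * 0.089424375531"
    using rzeta_even_values(5) upp(4) by (intro mult_mono) auto
  have p6: "(rzeta 12 - 1) * 6 powr (-s) \<le> 0.000246086554 * 0.068025846703"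
    using rzeta_even_values(6) upp(5) by (intro mult_mono) auto
  have p7: "(rzeta 14 - 1) * 7 powr (-s) \<le> 0.000061248136 * 0.053981536243"
    using rzeta_even_values(7) upp(6) by (intro mult_mono) auto
  have p8: "(rzeta 16 - 1) * 8 powr (-s) \<le> 0.000015282260 * 0.044182463651"
    using rzeta_even_values(8) upp(7) by (intro mult_mono) auto
  have p9: "(rzeta 18 - 1) * 9 powr (-s) \<le> 0.000003817294 * 0.037026667508"
    using rzeta_even_values(9) upp(8) by (intro mult_mono) auto
  have p10: "(rzeta 20 - 1) * 10 powr (-s) \<le> 0.000000953963 * 0.031613498458"
    using rzeta_even_values(10) upp(9) by (intro mult_mono) auto
  have p11: "(rzeta 22 - 1) * 11 powr (-s) \<le> 0.000000238451 * 0.027401747251"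
    using rzeta_even_values(11) upp(10) by (intro mult_mono) auto
  have p12: "(rzeta 24 - 1) * 12 powr (-s) \<le> 0.000000059609 * 0.024048644311"
    using rzeta_even_values(12) upp(11) by (intro mult_mono) auto
  have p13: "(rzeta 26 - 1) * 13 powr (-s) \<le> 0.000000014902 * 0.021327650217"
    using rzeta_even_values(13) upp(12) by (intro mult_mono) auto
  have p14: "(rzeta 28 - 1) * 14 powr (-s) \<le> 0.000000003726 * 0.019083669331"
    using rzeta_even_values(14) upp(13) by (intro mult_mono) auto
  have p15: "(rzeta 30 - 1) * 15 powr (-s) \<le> 0.000000000932 * 0.017207319760"
    using rzeta_even_values(15) upp(14) by (intro mult_mono) auto
  have "s > 1" by (simp add: s_def)
  show ?thesis
    unfolding s_def [symmetric]
    using dtail_split(2)[OF \<open>s > 1\<close>] rzeta_upper[folded s_def]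
      p2 p3 p4 p5 p6 p7 p8 p9 p10 p11 p12 p13 p14 p15 rzeta_even_values(1)
    by (simp add: atLeastLessThan_nat_numeral power_divide)
qed

section \<open>Existence, uniqueness and location of the root\<close>

theorem proposition4p1:
  shows "(\<forall>\<sigma>::real. (\<lambda>n::nat. zeta (of_nat (2 * n)) * of_nat n powr (- of_real \<sigma>))
                    summable_on {2..} \<longleftrightarrow> \<sigma> > 1)
    \<and> (\<exists>\<sigma>\<^sub>0::real.
          (\<forall>\<sigma>::real. ((\<lambda>n::nat. zeta (of_nat (2 * n)) * of_nat n powr (- of_real \<sigma>))
                    has_sum zeta 2) {2..} \<longleftrightarrow> \<sigma> = \<sigma>\<^sub>0)
        \<and> 1.500127440 \<le> \<sigma>\<^sub>0 \<and> \<sigma>\<^sub>0 < 1.500127441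
        \<and> (\<forall>s::complex. Re s \<ge> \<sigma>\<^sub>0 \<longrightarrow> D s \<noteq> 0))"
proof -
  have "\<exists>x\<ge>1.500127440. x \<le> 1.500127441 \<and> dtail x = rzeta 2"
    using dtail_lower dtail_upper by (intro IVT2' continuous_on_dtail) auto
  then obtain \<sigma>\<^sub>0 where root: "1.500127440 \<le> \<sigma>\<^sub>0" "\<sigma>\<^sub>0 \<le> 1.500127441" "dtail \<sigma>\<^sub>0 = rzeta 2"
    by blast
  then have gt_1: "\<sigma>\<^sub>0 > 1" by simp
  \<comment> \<open>The strict inequality at the right end excludes that endpoint, which fixes the
    nine decimals.\<close>
  have less: "\<sigma>\<^sub>0 < 1.500127441"
    using root dtail_upper by (cases "\<sigma>\<^sub>0 = 1.500127441") auto
  have zeta_2: "zeta 2 = of_real (rzeta 2)" using zeta_of_real[of 2] by simp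
  have "((\<lambda>n::nat. zeta (of_nat (2 * n)) * of_nat n powr (- of_real \<sigma>)) has_sum zeta 2) {2..}
      \<longleftrightarrow> \<sigma> = \<sigma>\<^sub>0" for \<sigma> :: real
  proof
    assume sum: "((\<lambda>n::nat. zeta (of_nat (2 * n)) * of_nat n powr (- of_real \<sigma>)) has_sum zeta 2) {2..}"
    \<comment> \<open>Having a sum already forces convergence, hence \<open>\<sigma> > 1\<close>,
      where \<open>dtail\<close> is the value of that sum.\<close>
    then have "\<sigma> > 1" using has_sum_imp_summable summable_on_summand_iff by blast
    with has_sum_unique[OF sum has_sum_dtail] have "dtail \<sigma> = dtail \<sigma>\<^sub>0"
      by (simp add: zeta_2 root(3))
    then show "\<sigma> = \<sigma>\<^sub>0"
      using dtail_strict_antimono[of \<sigma> \<sigma>\<^sub>0] dtail_strict_antimono[of \<sigma>\<^sub>0 \<sigma>] \<open>\<sigma> > 1\<close> gt_1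
      by (cases \<sigma> \<sigma>\<^sub>0 rule: linorder_cases) auto
  next
    assume "\<sigma> = \<sigma>\<^sub>0"
    then show "((\<lambda>n::nat. zeta (of_nat (2 * n)) * of_nat n powr (- of_real \<sigma>)) has_sum zeta 2) {2..}"
      using has_sum_dtail[OF gt_1] by (simp add: zeta_2 root(3))
  qed
  then show ?thesis
    using summable_on_summand_iff D_nonzero[OF gt_1 root(3)] root(1) less by blast
qed

end
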